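(* Let $\lambda\approx0.4464$ be the unique solution in $(0,1)$ of $\frac{x}{1-x}=\ln\frac1x$. Consider $n$ boxes with independent values $v_i\sim F_i$ and a number $\theta\ge 0$ given in advance, and assume that with probability $1$ the numbers $\theta,v_1,\dots,v_n$ are pairwise distinct. Let $\textsf{ALG}$ be the order-unaware algorithm defined in the context. Then for every arrival order $\pi$, $$\textsf{ALG}(\pi)\ \ge\ \ln\frac1\lambda\cdot\textsf{OPT}(\pi)\ \ (\approx 0.806\,\textsf{OPT}(\pi)),$$ where $\textsf{ALG}(\pi)$, $\textsf{OPT}(\pi)$ are the winning probabilities of $\textsf{ALG}$ and of the best order-aware online algorithm under arrival order $\pi$. In particular (taking $\theta=0$), this holds for the objective of maximizing the probability of accepting the box with the largest value.
   Context: Setting (max-probability objective, generalized with a threshold $\theta$): there are $n$ boxes with independent values $v_i\sim F_i$, distributions known in advance. Boxes arrive one at a time in arrival order $\pi$; upon arrival a box's identity and realized value are revealed and an online algorithm must immediately and irrevocably accept it (and stop) or reject it forever. The algorithm wins if the box it accepts has value greater than $\theta$ and greater than the values of all other boxes; if all values are below $\theta$, or nothing is accepted, it loses. An order-aware algorithm knows $\pi$ in advance; an order-unaware algorithm's decisions may depend only on the distributions, $\theta$, and the identities and realized values of boxes arrived so far. $\textsf{OPT}(\pi)$ is the maximum winning probability over all order-aware online algorithms under order $\pi$. The algorithm $\textsf{ALG}$: relabel boxes so they arrive in order $1,\dots,n$, let $\theta_0=\theta$ and $\theta_s$ be the realized value of box $s$. At round $t$, $\textsf{ALG}$ accepts box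 $t$ if and only if $\theta_t=\max_{0\le s\le t}\theta_s$ and $\Pr\left[\max_{t<s\le n}v_s<\theta_t\right]\ge\lambda$ (the probability being over the values of the boxes not yet arrived; the maximum over an empty set is $-\infty$). This probability depends only on the set of remaining boxes, so $\textsf{ALG}$ is order-unaware. *)

theory Defs
  imports "HOL-Probability.Probability"
begin

text \<open>Boxes are indexed by identities 0..n-1; box i has value distribution F i.
  The joint law of the values is the product measure PiM {..<n} F (independence).
  The arrival order pi is a bijection of {..<n}: box pi t arrives at (0-based) time t.
  An arrival sequence y :: nat => real gives y t = value of the box arriving at time t.
  A (deterministic) online stopping rule stop t y decides whether to accept at time t;
  it may only depend on y 0, ..., y t.\<close>

definition box_space :: "nat \<Rightarrow> (nat \<Rightarrow> real measure) \<Rightarrow> (nat \<Rightarrow> real) measure" where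
  "box_space n F = PiM {..<n} F"

definition online_rule ::
  "nat \<Rightarrow> (nat \<Rightarrow> real measure) \<Rightarrow> (nat \<Rightarrow> nat) \<Rightarrow> (nat \<Rightarrow> (nat \<Rightarrow> real) \<Rightarrow> bool) \<Rightarrow> bool" where
  "online_rule n F \<pi> stop \<longleftrightarrow>
     (\<forall>t<n. (\<forall>y y'. (\<forall>s\<le>t. y s = y' s) \<longrightarrow> stop t y = stop t y') \<and>
            {v \<in> space (box_space n F). stop t (\<lambda>s. v (\<pi> s))} \<in> sets (box_space n F))"

definition wins :: "nat \<Rightarrow> real \<Rightarrow> (nat \<Rightarrow> (nat \<Rightarrow> real) \<Rightarrow> bool) \<Rightarrow> (nat \<Rightarrow> real) \<Rightarrow> bool" where
  "wins n \<theta> stop y \<longleftrightarrow>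
     (\<exists>t<n. stop t y \<and> (\<forall>s<t. \<not> stop s y) \<and> \<theta> < y t \<and> (\<forall>s<n. s \<noteq> t \<longrightarrow> y s < y t))"

definition win_prob ::
  "nat \<Rightarrow> (nat \<Rightarrow> real measure) \<Rightarrow> (nat \<Rightarrow> nat) \<Rightarrow> real \<Rightarrow> (nat \<Rightarrow> (nat \<Rightarrow> real) \<Rightarrow> bool) \<Rightarrow> real" where
  "win_prob n F \<pi> \<theta> stop =
     measure (box_space n F) {v \<in> space (box_space n F). wins n \<theta> stop (\<lambda>s. v (\<pi> s))}"

definition OPT :: "nat \<Rightarrow> (nat \<Rightarrow> real measure) \<Rightarrow> (nat \<Rightarrow> nat) \<Rightarrow> real \<Rightarrow> real" where
  "OPT n F \<pi> \<theta> = Sup (win_prob n F \<pi> \<theta> ` {stop. online_rule n F \<pi> stop})"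

definition alg_rule ::
  "nat \<Rightarrow> (nat \<Rightarrow> real measure) \<Rightarrow> (nat \<Rightarrow> nat) \<Rightarrow> real \<Rightarrow> real \<Rightarrow> nat \<Rightarrow> (nat \<Rightarrow> real) \<Rightarrow> bool" where
  "alg_rule n F \<pi> \<theta> lam t y \<longleftrightarrow>
     \<theta> \<le> y t \<and> (\<forall>s<t. y s \<le> y t) \<and>
     lam \<le> measure (PiM {t<..<n} (\<lambda>s. F (\<pi> s))) {w \<in> space (PiM {t<..<n} (\<lambda>s. F (\<pi> s))). \<forall>s\<in>{t<..<n}. w s < y t}"

definition box_lambda :: real where
  "box_lambda = (THE x. 0 < x \<and> x < 1 \<and> x / (1 - x) = ln (1 / x))"

end

theory Submission
  imports Defs
begin

text \<open>Let \<open>q\<close> be the probability that no remaining box exceeds the current record and let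
  \<open>c = ln (1/\<lambda>) = \<lambda>/(1 - \<lambda>)\<close>. By backward induction the algorithm wins from such a state with
  probability at least \<open>m * ln (1/m)\<close> where \<open>m = max q \<lambda>\<close>; the inductive step is
  \<open>ln z \<le> z - 1\<close>, together with \<open>c \<le> 1\<close>. Now compare with any other rule. At a record with
  \<open>q \<ge> \<lambda>\<close> the algorithm accepts and gets \<open>q\<close>, while the other rule gets at most
  \<open>max q (1 - q) \<le> q / c\<close>. At a record with \<open>q < \<lambda>\<close> the algorithm continues: if the other rule
  accepts, it gets \<open>q < \<lambda>\<close>, and the algorithm still gets at least \<open>\<lambda> * ln (1/\<lambda>) = c * \<lambda>\<close>; if
  it continues as well, induction applies.\<close>

section \<open>The constant \<open>box_lambda\<close>\<close>

text \<open>The function \<open>f\<close> is strictly increasing on the unit interval and changes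
  sign between \<open>exp (- 1)\<close> and \<open>1 / 2\<close>, so the definite description has
  exactly one solution. The left end of this bracket yields
  \<open>ln (1 / box_lambda) \<le> 1\<close>.\<close>

lemma box_lambda_facts:
  shows box_lambda_pos: "0 < box_lambda" and box_lambda_less_1: "box_lambda < 1"
    and box_lambda_eq: "box_lambda / (1 - box_lambda) = ln (1 / box_lambda)"
    and ln_inverse_box_lambda_le_1: "ln (1 / box_lambda) \<le> 1"
proof -
  define f :: "real \<Rightarrow> real" where "f x = x / (1 - x) + ln x" for x
  have f_less: "f x < f y" if "0 < x" "x < y" "y < 1" for x y
  proof -
    have "x / (1 - x) < y / (1 - y)" using that by (simp add: field_simps)
    moreover have "ln x < ln y" using that by simp
    ultimately show ?thesis by (simp add: f_def)
  qed
  have e: "exp (- 1 :: real) \<le> 1 / 2"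
    using exp_ge_add_one_self[of "1::real"] by (simp add: exp_minus field_simps)
  have "f (exp (- 1)) \<le> 0" using e by (simp add: f_def field_simps)
  moreover have "0 \<le> f (1 / 2)"
    using ln_le_minus_one[of "2::real"] by (simp add: f_def ln_div)
  moreover have "continuous_on {exp (- 1)..1 / 2} f"
    unfolding f_def using exp_gt_zero[of "- 1 :: real"]
    by (intro continuous_intros) (auto simp del: exp_gt_zero)
  ultimately obtain l where l: "exp (- 1) \<le> l" "l \<le> 1 / 2" "f l = 0"
    using IVT'[of f "exp (- 1)" 0 "1 / 2"] e by auto
  have l0: "0 < l" using l(1) exp_gt_zero[of "- 1 :: real"] by linarith
  have f_zero: "f x = 0 \<longleftrightarrow> x / (1 - x) = ln (1 / x)" if "0 < x" for x
    using that by (auto simp: f_def ln_div)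
  have "box_lambda = l"
    unfolding box_lambda_def
  proof (rule the_equality)
    show "0 < l \<and> l < 1 \<and> l / (1 - l) = ln (1 / l)" using l l0 f_zero by auto
    show "x = l" if x: "0 < x \<and> x < 1 \<and> x / (1 - x) = ln (1 / x)" for x
    proof -
      have "f x = f l" using x f_zero l by auto
      then show ?thesis using f_less[of x l] f_less[of l x] x l l0 by force
    qed
  qed
  moreover have "- 1 \<le> ln l" using ln_mono[OF l(1)] by simp
  ultimately show "0 < box_lambda" "box_lambda < 1"
    "box_lambda / (1 - box_lambda) = ln (1 / box_lambda)" "ln (1 / box_lambda) \<le> 1"
    using l l0 f_zero by (auto simp: ln_div)
qed

lemma ln_inverse_box_lambda_pos: "0 < ln (1 / box_lambda)"
  using box_lambda_pos box_lambda_less_1 by (simp add: ln_div)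

lemma ln_inverse_box_lambda_times: "ln (1 / box_lambda) * (1 - box_lambda) = box_lambda"
  using box_lambda_eq box_lambda_less_1 by (simp add: field_simps)

section \<open>Integrals of functions with values in the unit interval\<close>

context prob_space
begin

lemma integrable_unit:
  fixes f :: "'a \<Rightarrow> real"
  assumes "f \<in> borel_measurable M" "\<And>x. 0 \<le> f x" "\<And>x. f x \<le> 1"
  shows "integrable M f"
  using assms by (intro integrable_const_bound[where B = 1]) (auto simp: abs_of_nonneg)

lemma integral_unit:
  fixes f :: "'a \<Rightarrow> real"
  assumes "\<And>x. 0 \<le> f x" "\<And>x. f x \<le> 1"
  shows "0 \<le> integral\<^sup>L M f" "integral\<^sup>L M f \<le> 1"
  using assms integral_mono[of M f "\<lambda>_. 1"]
  \<comment> \<open>The integral of a non-integrable function is 0 by convention, which lies within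
    both bounds.\<close>
  by (cases "integrable M f"; auto simp: prob_space not_integrable_integral_eq)+

end

lemma
  fixes a b x :: real and N :: "real measure"
  assumes N: "prob_space N" and [measurable_cong]: "sets N = sets borel"
  shows integrable_threshold: "integrable N (\<lambda>z. if z \<le> x then a else b)"
    and integral_threshold: "(\<integral>z. (if z \<le> x then a else b) \<partial>N)
      = measure N {..x} * a + (1 - measure N {..x}) * b"
proof -
  interpret N: prob_space N by fact
  have sp: "space N = UNIV" using sets_eq_imp_space_eq[OF assms(2)] by simp
  have eq: "(\<lambda>z. if z \<le> x then a else b) = (\<lambda>z. indicator {..x} z * (a - b) + b)"
    by (auto simp: indicator_def)
  have int: "integrable N (\<lambda>z. indicator {..x} z :: real)"
    by (rule N.integrable_unit) (auto simp: indicator_def)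
  show "integrable N (\<lambda>z. if z \<le> x then a else b)"
    unfolding eq by (intro Bochner_Integration.integrable_add integrable_mult_left int) auto
  show "(\<integral>z. (if z \<le> x then a else b) \<partial>N)
      = measure N {..x} * a + (1 - measure N {..x}) * b"
    unfolding eq using int by (simp add: sp N.prob_space[unfolded sp] algebra_simps)
qed

section \<open>Records and wins\<close>

text \<open>The threshold acts as an initial record. Box \<open>t\<close> itself is excluded, so
  \<open>runmax \<theta> y t < y t\<close> says that box \<open>t\<close> sets a new record.\<close>

primrec runmax :: "real \<Rightarrow> (nat \<Rightarrow> real) \<Rightarrow> nat \<Rightarrow> real" where
  "runmax \<theta> y 0 = \<theta>"
| "runmax \<theta> y (Suc t) = max (runmax \<theta> y t) (y t)"

lemma runmax_less_iff: "runmax \<theta> y t < z \<longleftrightarrow> \<theta> < z \<and> (\<forall>s<t. y s < z)"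
  by (induction t) (auto simp: less_Suc_eq)

lemma runmax_cong: "(\<And>s. s < t \<Longrightarrow> y s = y' s) \<Longrightarrow> runmax \<theta> y t = runmax \<theta> y' t"
  by (induction t) auto

definition waiting :: "(nat \<Rightarrow> (nat \<Rightarrow> real) \<Rightarrow> bool) \<Rightarrow> nat \<Rightarrow> (nat \<Rightarrow> real) \<Rightarrow> bool" where
  "waiting stop t y \<longleftrightarrow> (\<forall>s<t. \<not> stop s y)"

lemma waiting_Suc: "waiting stop (Suc t) y \<longleftrightarrow> waiting stop t y \<and> \<not> stop t y"
  by (auto simp: waiting_def less_Suc_eq)

definition takes_record ::
  "real \<Rightarrow> (nat \<Rightarrow> (nat \<Rightarrow> real) \<Rightarrow> bool) \<Rightarrow> nat \<Rightarrow> (nat \<Rightarrow> real) \<Rightarrow> bool" where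
  "takes_record \<theta> stop t y \<longleftrightarrow> waiting stop t y \<and> stop t y \<and> runmax \<theta> y t < y t"

text \<open>Unlike in \<^const>\<open>wins\<close>, later boxes may tie with the accepted one. The no-ties
  hypothesis holds only almost surely for the random values, not at an arbitrary fixed
  threshold, which may be an atom of some box; weak inequalities keep the backward
  recursions below exact at such thresholds.\<close>

definition weak_wins :: "nat \<Rightarrow> real \<Rightarrow> (nat \<Rightarrow> (nat \<Rightarrow> real) \<Rightarrow> bool) \<Rightarrow> (nat \<Rightarrow> real) \<Rightarrow> bool" where
  "weak_wins n \<theta> stop y \<longleftrightarrow> (\<exists>t<n. takes_record \<theta> stop t y \<and> (\<forall>r\<in>{t<..<n}. y r \<le> y t))"

text \<open>This holds for every outcome, ties included, so upper bounds for weak wins carry over to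
  \<open>wins\<close> without any almost-sure argument.\<close>

lemma wins_imp_weak_wins: "wins n \<theta> stop y \<Longrightarrow> weak_wins n \<theta> stop y"
  unfolding wins_def weak_wins_def takes_record_def waiting_def runmax_less_iff
  by (fastforce intro: less_imp_le)

section \<open>Independent boxes and their tail distributions\<close>

locale online_boxes =
  fixes n :: nat and F :: "nat \<Rightarrow> real measure" and \<theta> :: real and \<pi> :: "nat \<Rightarrow> nat"
  assumes prob_space_box: "i < n \<Longrightarrow> prob_space (F i)"
    and sets_box: "i < n \<Longrightarrow> sets (F i) = sets borel"
    and order: "bij_betw \<pi> {..<n} {..<n}"
begin

abbreviation M :: "(nat \<Rightarrow> real) measure" where
  "M \<equiv> box_space n F"

abbreviation arrivals :: "(nat \<Rightarrow> real) \<Rightarrow> nat \<Rightarrow> real" where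
  "arrivals v \<equiv> \<lambda>s. v (\<pi> s)"

lemma order_less: "t < n \<Longrightarrow> \<pi> t < n"
  using order by (auto simp: bij_betw_def)

lemma order_eq_iff: "s < n \<Longrightarrow> t < n \<Longrightarrow> \<pi> s = \<pi> t \<longleftrightarrow> s = t"
  using order by (auto simp: bij_betw_def inj_on_def)

lemma space_box: "i < n \<Longrightarrow> space (F i) = UNIV"
  using sets_eq_imp_space_eq[OF sets_box] by simp

sublocale prob_space M
  unfolding box_space_def by (rule prob_space_PiM) (simp add: prob_space_box)

lemma measurable_on_box: "f \<in> measurable borel N \<Longrightarrow> i < n \<Longrightarrow> f \<in> measurable (F i) N"
  using measurable_cong_sets[OF sets_box refl] by blast

lemma measurable_box: "i < n \<Longrightarrow> (\<lambda>v. v i) \<in> borel_measurable M"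
  unfolding box_space_def
  using measurable_component_singleton[of i "{..<n}" F] measurable_cong_sets[OF refl sets_box[of i]]
  by blast

lemma measurable_arrival [measurable]: "t < n \<Longrightarrow> (\<lambda>v. v (\<pi> t)) \<in> borel_measurable M"
  by (intro measurable_box order_less)

lemma
  assumes "s < n" "t < n"
  shows pred_arrival_le: "Measurable.pred M (\<lambda>v. v (\<pi> s) \<le> v (\<pi> t))"
    and pred_arrival_less: "Measurable.pred M (\<lambda>v. v (\<pi> s) < v (\<pi> t))"
  using measurable_arrival[OF assms(1)] measurable_arrival[OF assms(2)]
  by (simp_all add: pred_def borel_measurable_le borel_measurable_less)

lemma measurable_runmax [measurable]:
  "t \<le> n \<Longrightarrow> (\<lambda>v. runmax \<theta> (arrivals v) t) \<in> borel_measurable M"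
  by (induction t) auto

text \<open>Replacing coordinate \<open>i\<close> by an independent copy does not change the product measure.\<close>

lemma resample:
  fixes f :: "(nat \<Rightarrow> real) \<Rightarrow> real \<Rightarrow> real"
  assumes i: "i < n"
    and f: "(\<lambda>(v, z). f v z) \<in> borel_measurable (M \<Otimes>\<^sub>M borel)"
    and bounds: "\<And>v z. 0 \<le> f v z" "\<And>v z. f v z \<le> 1"
    and indep: "\<And>v z z'. f (v(i := z')) z = f v z"
  shows "(\<integral>v. f v (v i) \<partial>M) = (\<integral>v. (\<integral>z. f v z \<partial>F i) \<partial>M)"
    and "(\<lambda>v. \<integral>z. f v z \<partial>F i) \<in> borel_measurable M"
proof -
  interpret Fi: prob_space "F i" using i by (rule prob_space_box)
  interpret P: pair_prob_space "F i" M ..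
  note [measurable_cong] = sets_box[OF i]
  have f'[measurable]: "(\<lambda>(v, z). f v z) \<in> borel_measurable (M \<Otimes>\<^sub>M F i)"
    using f by measurable
  have upd[measurable]: "(\<lambda>(x, v). v(i := x)) \<in> measurable (F i \<Otimes>\<^sub>M M) M"
    unfolding box_space_def split_beta'
    by (rule measurable_fun_upd[where J = "{..<n}"]) (use i in auto)
  have "distr (F i \<Otimes>\<^sub>M M) M (\<lambda>(x, v). v(i := x)) = M"
    using distr_pair_PiM_eq_PiM[of "{..<n}" F i] i
    by (simp add: prob_space_box insert_absorb box_space_def)
  then have "(\<integral>v. f v (v i) \<partial>M)
      = (\<integral>v. f v (v i) \<partial>distr (F i \<Otimes>\<^sub>M M) M (\<lambda>(x, v). v(i := x)))"
    by simp
  also have "\<dots> = (\<integral>p. f ((snd p)(i := fst p)) (fst p) \<partial>(F i \<Otimes>\<^sub>M M))"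
    using measurable_box[OF i] by (subst integral_distr) (auto simp: split_beta')
  also have "\<dots> = (\<integral>(x, v). f v x \<partial>(F i \<Otimes>\<^sub>M M))"
    by (simp add: indep split_beta')
  also have "\<dots> = (\<integral>v. (\<integral>z. f v z \<partial>F i) \<partial>M)"
    by (rule P.integral_snd[symmetric]) (rule P.integrable_unit, auto simp: bounds)
  finally show "(\<integral>v. f v (v i) \<partial>M) = (\<integral>v. (\<integral>z. f v z \<partial>F i) \<partial>M)" .
  show "(\<lambda>v. \<integral>z. f v z \<partial>F i) \<in> borel_measurable M" by measurable
qed

text \<open>By independence, the probability that no box arriving at time \<open>t\<close> or later
  exceeds \<open>x\<close>; this is the \<open>q\<close> of the opening idea.\<close>

definition tail_cdf :: "nat \<Rightarrow> real \<Rightarrow> real" where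
  "tail_cdf t x = (\<Prod>s\<in>{t..<n}. measure (F (\<pi> s)) {..x})"

lemma measure_box_le_1: "i < n \<Longrightarrow> measure (F i) A \<le> 1"
  using prob_space.prob_le_1[OF prob_space_box] .

lemma mono_box_cdf: "i < n \<Longrightarrow> mono (\<lambda>x. measure (F i) {..x})"
  using prob_space.finite_measure[OF prob_space_box] sets_box
  by (auto intro!: monoI finite_measure.finite_measure_mono)

lemma measurable_box_cdf [measurable]: "i < n \<Longrightarrow> (\<lambda>x. measure (F i) {..x}) \<in> borel_measurable borel"
  by (intro borel_measurable_mono mono_box_cdf)

lemma tail_cdf_nonneg: "0 \<le> tail_cdf t x"
  by (simp add: tail_cdf_def prod_nonneg)

lemma tail_cdf_le_1: "tail_cdf t x \<le> 1"
  by (auto simp: tail_cdf_def intro!: prod_le_1 measure_box_le_1 order_less)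

lemma tail_cdf_n: "tail_cdf n x = 1"
  by (simp add: tail_cdf_def)

lemma tail_cdf_rec: "t < n \<Longrightarrow> tail_cdf t x = measure (F (\<pi> t)) {..x} * tail_cdf (Suc t) x"
  by (simp add: tail_cdf_def prod.atLeast_Suc_lessThan)

lemma tail_cdf_mono: "x \<le> z \<Longrightarrow> tail_cdf t x \<le> tail_cdf t z"
  unfolding tail_cdf_def
  by (auto intro!: prod_mono monoD[OF mono_box_cdf] order_less)

lemma measurable_tail_cdf [measurable]: "tail_cdf t \<in> borel_measurable borel"
  by (intro borel_measurable_mono monoI tail_cdf_mono)

section \<open>The value of the algorithm\<close>

text \<open>The probability that the algorithm weakly wins if nothing was accepted before time
  \<open>t\<close> and the record is \<open>x\<close>. Defining it by backward recursion at every
  real \<open>x\<close> avoids conditional probabilities.\<close>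

function alg_val :: "nat \<Rightarrow> real \<Rightarrow> real" where
  "alg_val t x = (if t < n
     then \<integral>z. (if z \<le> x then alg_val (Suc t) x
       else if box_lambda \<le> tail_cdf (Suc t) z then tail_cdf (Suc t) z
       else alg_val (Suc t) z) \<partial>F (\<pi> t)
     else 0)"
  by auto
termination by (relation "Wellfounded.measure (\<lambda>(t, _). n - t)") auto

declare alg_val.simps [simp del]

lemma alg_val_n: "alg_val n x = 0"
  by (simp add: alg_val.simps)

text \<open>The integrand of \<open>alg_val\<close>, named so that it can be compared pointwise with
  its counterpart \<open>opt_gain\<close>.\<close>

definition alg_gain :: "nat \<Rightarrow> real \<Rightarrow> real \<Rightarrow> real" where
  "alg_gain t x z = (if z \<le> x then alg_val (Suc t) x
     else if box_lambda \<le> tail_cdf (Suc t) z then tail_cdf (Suc t) z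
     else alg_val (Suc t) z)"

lemma alg_val_rec: "t < n \<Longrightarrow> alg_val t x = (\<integral>z. alg_gain t x z \<partial>F (\<pi> t))"
  by (subst alg_val.simps) (simp add: alg_gain_def[abs_def])

lemma alg_val_properties:
  assumes "t \<le> n"
  shows "alg_val t \<in> borel_measurable borel \<and> (\<forall>x. 0 \<le> alg_val t x \<and> alg_val t x \<le> 1)"
  using assms
proof (induction t rule: inc_induct)
  case base
  then show ?case by (simp add: alg_val_n[abs_def])
next
  case (step t)
  then have t: "t < n" by simp
  interpret B: prob_space "F (\<pi> t)" by (intro prob_space_box order_less t)
  note [measurable_cong] = sets_box[OF order_less[OF t]]
  have [measurable]: "alg_val (Suc t) \<in> borel_measurable borel" using step.IH by simp
  have "(\<lambda>x. \<integral>z. alg_gain t x z \<partial>F (\<pi> t)) \<in> borel_measurable borel"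
    unfolding alg_gain_def by measurable
  moreover have "0 \<le> alg_gain t x z" "alg_gain t x z \<le> 1" for x z
    using step.IH by (auto simp: alg_gain_def tail_cdf_nonneg tail_cdf_le_1)
  ultimately show ?case
    using B.integral_unit[of "alg_gain t _"] by (simp add: alg_val_rec[OF t, abs_def])
qed

lemma measurable_alg_val [measurable]: "t \<le> n \<Longrightarrow> alg_val t \<in> borel_measurable borel"
  and alg_val_nonneg: "t \<le> n \<Longrightarrow> 0 \<le> alg_val t x"
  and alg_val_le_1: "t \<le> n \<Longrightarrow> alg_val t x \<le> 1"
  using alg_val_properties by auto

lemma alg_gain_nonneg: "t < n \<Longrightarrow> 0 \<le> alg_gain t x z"
  and alg_gain_le_1: "t < n \<Longrightarrow> alg_gain t x z \<le> 1"
  by (simp_all add: alg_gain_def tail_cdf_nonneg tail_cdf_le_1 alg_val_nonneg alg_val_le_1)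

lemma measurable_alg_gain [measurable]:
  "t < n \<Longrightarrow> (\<lambda>(x, z). alg_gain t x z) \<in> borel_measurable (borel \<Otimes>\<^sub>M borel)"
  unfolding alg_gain_def by measurable

text \<open>The function that is \<open>a\<close> up to \<open>x\<close> and \<open>b\<close> beyond
  lies below \<open>f\<close> and has an explicit integral.\<close>

lemma integral_ge_threshold:
  assumes t: "t < n"
    and f: "f \<in> borel_measurable borel" "\<And>z. 0 \<le> f z" "\<And>z. f z \<le> 1"
    and ge: "\<And>z. z \<le> x \<Longrightarrow> a \<le> f z" "\<And>z. x < z \<Longrightarrow> b \<le> f z"
  shows "measure (F (\<pi> t)) {..x} * a + (1 - measure (F (\<pi> t)) {..x}) * b
    \<le> (\<integral>z. f z \<partial>F (\<pi> t))"
proof -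
  have i: "\<pi> t < n" using t by (rule order_less)
  interpret B: prob_space "F (\<pi> t)" using i by (rule prob_space_box)
  note [measurable_cong] = sets_box[OF i]
  have "f \<in> borel_measurable (F (\<pi> t))" using f(1) i by (rule measurable_on_box)
  then have "integrable (F (\<pi> t)) f" using f by (intro B.integrable_unit) auto
  then have "(\<integral>z. (if z \<le> x then a else b) \<partial>F (\<pi> t)) \<le> (\<integral>z. f z \<partial>F (\<pi> t))"
    using ge by (intro integral_mono integrable_threshold prob_space_box sets_box i) auto
  then show ?thesis
    by (simp add: integral_threshold[OF prob_space_box sets_box] i)
qed

lemma alg_val_ge:
  assumes "t \<le> n"
  shows "max (tail_cdf t x) box_lambda * ln (1 / max (tail_cdf t x) box_lambda) \<le> alg_val t x"
  using assms
proof (induction t arbitrary: x rule: inc_induct)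
  case base
  then show ?case using box_lambda_less_1 by (simp add: tail_cdf_n alg_val_n)
next
  case (step t)
  then have t: "t < n" by simp
  let ?l = box_lambda
  define h where "h q = max q ?l * ln (1 / max q ?l)" for q
  define p q q' where "p = measure (F (\<pi> t)) {..x}"
    and "q = tail_cdf t x" and "q' = tail_cdf (Suc t) x"
  have q: "q = p * q'" using tail_cdf_rec[OF t] by (simp add: p_def q_def q'_def)
  have p: "0 \<le> p" "p \<le> 1" unfolding p_def by (auto intro: measure_box_le_1 order_less t)
  have q': "0 \<le> q'" "q' \<le> 1" by (auto simp: q'_def tail_cdf_nonneg tail_cdf_le_1)
  have IH: "h (tail_cdf (Suc t) z) \<le> alg_val (Suc t) z" for z
    using step.IH by (simp add: h_def)
  have hl: "h ?l \<le> ?l"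
    using ln_inverse_box_lambda_le_1 box_lambda_pos by (simp add: h_def mult_left_le)
  have bound: "p * a + (1 - p) * b \<le> alg_val t x"
    if "a \<le> alg_val (Suc t) x" "\<And>z. x < z \<Longrightarrow> b \<le> alg_gain t x z" for a b
    unfolding p_def alg_val_rec[OF t] using that t
    by (intro integral_ge_threshold)
      (auto simp: alg_gain_nonneg alg_gain_le_1, auto simp: alg_gain_def)
  have "h q \<le> alg_val t x"
  proof (cases "?l \<le> q'")
    case True
    have q'0: "0 < q'" using True box_lambda_pos by simp
    \<comment> \<open>A new record exceeds \<open>x\<close>, so its tail probability is at least
      \<open>q'\<close>, hence at least \<open>box_lambda\<close>: it is accepted.\<close>
    have "p * h q' + (1 - p) * q' \<le> alg_val t x"
    proof (rule bound)
      show "h q' \<le> alg_val (Suc t) x" using IH by (simp add: q'_def)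
      show "q' \<le> alg_gain t x z" if "x < z" for z
        using that True tail_cdf_mono[of x z "Suc t"] by (auto simp: alg_gain_def q'_def)
    qed
    moreover have "p * h q' + (1 - p) * q' = q' - q * (1 - ln (1 / q'))"
      using True by (simp add: h_def q algebra_simps max_absorb1)
    \<comment> \<open>It remains to replace \<open>q\<close> by the larger \<open>m\<close>. This
      lowers the bound, because \<open>1 - ln (1 / q')\<close> is nonnegative by
      \<open>ln (1 / q') \<le> ln (1 / box_lambda) \<le> 1\<close>.\<close>
    moreover define m where "m = max q ?l"
    have m: "0 < m" "m \<le> q'" "q \<le> m"
      using True box_lambda_pos p q' by (auto simp: m_def q mult_left_le_one_le)
    have "ln (1 / q') \<le> ln (1 / ?l)" using True q'0 box_lambda_pos by (simp add: ln_div)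
    then have "q * (1 - ln (1 / q')) \<le> m * (1 - ln (1 / q'))"
      using m ln_inverse_box_lambda_le_1 by (intro mult_right_mono) auto
    \<comment> \<open>The inequality \<open>ln z \<le> z - 1\<close> at
      \<open>z = q' / m\<close>.\<close>
    moreover have "m * ln (q' / m) \<le> m * (q' / m - 1)"
      using m q'0 by (intro mult_left_mono ln_le_minus_one) auto
    then have "m * ln (1 / m) \<le> q' - m * (1 - ln (1 / q'))"
      using m q'0 by (simp add: ln_div algebra_simps)
    ultimately show ?thesis by (simp add: h_def m_def)
  next
    case False
    \<comment> \<open>Here \<open>h\<close> is constant below \<open>box_lambda\<close>, and each
      branch pays at least \<open>h ?l\<close>: an accepted record by \<open>hl\<close>, the others
      by induction.\<close>
    have "q \<le> ?l" using False p q' mult_left_le_one_le[of q' p] by (simp add: q)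
    then have "h q = h ?l" by (simp add: h_def)
    moreover have "p * h ?l + (1 - p) * h ?l \<le> alg_val t x"
    proof (rule bound)
      show "h ?l \<le> alg_val (Suc t) x" using IH[of x] False by (simp add: h_def q'_def)
      show "h ?l \<le> alg_gain t x z" if "x < z" for z
        using that hl IH[of z] by (auto simp: alg_gain_def h_def)
    qed
    ultimately show ?thesis by (simp add: algebra_simps)
  qed
  then show ?case by (simp add: h_def q_def)
qed

section \<open>An upper bound for every online rule\<close>

text \<open>An upper bound for the optimal winning probability when the boxes from time \<open>t\<close> on are
  still to come and the record is \<open>x\<close>; the first term is there because one of these
  boxes has to exceed \<open>x\<close>. Being a supersolution of the optimality recursion
  (\<open>opt_bound_step\<close>), it makes a detour through the optimal value itself unnecessary.\<close>

definition opt_bound :: "nat \<Rightarrow> real \<Rightarrow> real" where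
  "opt_bound t x = min (1 - tail_cdf t x) (alg_val t x / ln (1 / box_lambda))"

lemma opt_bound_n: "opt_bound n x = 0"
  by (simp add: opt_bound_def tail_cdf_n alg_val_n)

lemma opt_bound_le_alg_val: "ln (1 / box_lambda) * opt_bound t x \<le> alg_val t x"
proof -
  let ?c = "ln (1 / box_lambda)"
  have c: "0 < ?c" by (rule ln_inverse_box_lambda_pos)
  then have "?c * opt_bound t x \<le> ?c * (alg_val t x / ?c)"
    by (intro mult_left_mono) (auto simp: opt_bound_def)
  then show ?thesis using c by simp
qed

lemma opt_bound_nonneg: "t \<le> n \<Longrightarrow> 0 \<le> opt_bound t x"
  using ln_inverse_box_lambda_pos
  by (simp add: opt_bound_def tail_cdf_le_1 alg_val_nonneg)

lemma opt_bound_le_1: "opt_bound t x \<le> 1"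
  using tail_cdf_nonneg[of t x] by (simp add: opt_bound_def)

lemma measurable_opt_bound [measurable]: "t \<le> n \<Longrightarrow> opt_bound t \<in> borel_measurable borel"
  unfolding opt_bound_def by measurable

text \<open>The integrand of the optimality recursion, with \<open>opt_bound\<close> as continuation
  value: at a new record the better of accepting and continuing counts, while any other box cannot
  win and is passed.\<close>

definition opt_gain :: "nat \<Rightarrow> real \<Rightarrow> real \<Rightarrow> real" where
  "opt_gain t x z = (if z \<le> x then opt_bound (Suc t) x
     else max (tail_cdf (Suc t) z) (opt_bound (Suc t) z))"

lemma opt_gain_nonneg: "t < n \<Longrightarrow> 0 \<le> opt_gain t x z"
  and opt_gain_le_1: "t < n \<Longrightarrow> opt_gain t x z \<le> 1"
  by (simp_all add: opt_gain_def tail_cdf_nonneg tail_cdf_le_1 opt_bound_nonneg opt_bound_le_1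
      le_max_iff_disj)

lemma measurable_opt_gain [measurable]:
  "t < n \<Longrightarrow> (\<lambda>(x, z). opt_gain t x z) \<in> borel_measurable (borel \<Otimes>\<^sub>M borel)"
  unfolding opt_gain_def by measurable

text \<open>The defining equation of \<open>box_lambda\<close> enters in \<open>accept\<close>: the
  first term of \<open>opt_bound\<close> is at most \<open>1 - ?l\<close>, and
  \<open>?c * (1 - ?l) = ?l\<close>. In \<open>reject\<close>, \<open>alg_val_ge\<close> supplies
  \<open>?l * ?c\<close>. All other branches reduce to \<open>opt_bound_le_alg_val\<close> or to
  \<open>?c \<le> 1\<close>.\<close>

lemma opt_gain_le_alg_gain:
  assumes "t < n"
  shows "ln (1 / box_lambda) * opt_gain t x z \<le> alg_gain t x z"
proof -
  let ?l = box_lambda and ?c = "ln (1 / box_lambda)" and ?q = "tail_cdf (Suc t) z"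
  have c: "0 < ?c" "?c \<le> 1" "?c * (1 - ?l) = ?l"
    using ln_inverse_box_lambda_pos ln_inverse_box_lambda_le_1 ln_inverse_box_lambda_times .
  have accept: "?c * opt_bound (Suc t) z \<le> ?q" if "?l \<le> ?q"
  proof -
    have "?c * opt_bound (Suc t) z \<le> ?c * (1 - ?l)"
      using c that by (intro mult_left_mono) (auto simp: opt_bound_def)
    then show ?thesis using c that by simp
  qed
  have reject: "?c * ?q \<le> alg_val (Suc t) z" if "?q < ?l"
  proof -
    have "?c * ?q \<le> ?l * ?c" using c that by simp
    also have "\<dots> \<le> alg_val (Suc t) z"
      using alg_val_ge[of "Suc t" z] assms that by (simp add: max_absorb2)
    finally show ?thesis .
  qed
  have "?c * ?q \<le> ?q" using c by (simp add: mult_left_le_one_le tail_cdf_nonneg)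
  then show ?thesis
    using opt_bound_le_alg_val accept reject by (auto simp: opt_gain_def alg_gain_def max_def)
qed

text \<open>Each term of the minimum is treated separately. For the first, the gain is at most 1 at
  a record and \<open>1 - tail_cdf (Suc t) x\<close> otherwise, which averages to exactly
  \<open>1 - tail_cdf t x\<close>. For the second, the pointwise comparison is integrated.\<close>

lemma opt_bound_step:
  assumes t: "t < n"
  shows "(\<integral>z. opt_gain t x z \<partial>F (\<pi> t)) \<le> opt_bound t x"
proof -
  have i: "\<pi> t < n" using t by (rule order_less)
  interpret B: prob_space "F (\<pi> t)" using i by (rule prob_space_box)
  note [measurable_cong] = sets_box[OF i]
  have "opt_gain t x \<in> borel_measurable (F (\<pi> t))" "alg_gain t x \<in> borel_measurable (F (\<pi> t))"
    using measurable_Pair2[OF measurable_opt_gain[OF t], of x]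
      measurable_Pair2[OF measurable_alg_gain[OF t], of x]
    by (auto intro: measurable_on_box i)
  then have int: "integrable (F (\<pi> t)) (opt_gain t x)" "integrable (F (\<pi> t)) (alg_gain t x)"
    using t by (auto intro!: B.integrable_unit simp: opt_gain_nonneg opt_gain_le_1
      alg_gain_nonneg alg_gain_le_1)
  have "(\<integral>z. opt_gain t x z \<partial>F (\<pi> t))
      \<le> (\<integral>z. (if z \<le> x then 1 - tail_cdf (Suc t) x else 1) \<partial>F (\<pi> t))"
  proof (intro integral_mono int integrable_threshold prob_space_box sets_box i)
    show "opt_gain t x z \<le> (if z \<le> x then 1 - tail_cdf (Suc t) x else 1)" for z
      using opt_gain_le_1[OF t, of x z]
      by (cases "z \<le> x") (simp_all add: opt_gain_def opt_bound_def)
  qed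
  also have "\<dots> = 1 - tail_cdf t x"
    by (simp add: integral_threshold[OF prob_space_box sets_box] i tail_cdf_rec[OF t] algebra_simps)
  finally have 1: "(\<integral>z. opt_gain t x z \<partial>F (\<pi> t)) \<le> 1 - tail_cdf t x" .
  have "ln (1 / box_lambda) * (\<integral>z. opt_gain t x z \<partial>F (\<pi> t)) \<le> alg_val t x"
    unfolding alg_val_rec[OF t] integral_mult_right_zero[symmetric]
    using int opt_gain_le_alg_gain[OF t] by (intro integral_mono) auto
  with 1 show ?thesis
    using ln_inverse_box_lambda_pos by (simp add: opt_bound_def field_simps)
qed

end

section \<open>Winning probability of an arbitrary online rule\<close>

locale online_strategy = online_boxes +
  fixes stop :: "nat \<Rightarrow> (nat \<Rightarrow> real) \<Rightarrow> bool"
  assumes rule: "online_rule n F \<pi> stop"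
begin

lemma stop_cong: "t < n \<Longrightarrow> (\<And>s. s \<le> t \<Longrightarrow> y s = y' s) \<Longrightarrow> stop t y = stop t y'"
  using rule by (auto simp: online_rule_def)

lemma measurable_stop [measurable]: "t < n \<Longrightarrow> Measurable.pred M (\<lambda>v. stop t (arrivals v))"
  using rule by (auto simp: online_rule_def pred_def)

lemma measurable_waiting [measurable]:
  "t \<le> n \<Longrightarrow> Measurable.pred M (\<lambda>v. waiting stop t (arrivals v))"
proof (induction t)
  case 0
  then show ?case by (simp add: waiting_def)
next
  case (Suc t)
  then have [measurable]: "Measurable.pred M (\<lambda>v. waiting stop t (arrivals v))" and "t < n"
    by auto
  then show ?case unfolding waiting_Suc by measurable
qed

lemma measurable_takes_record [measurable]:
  "t < n \<Longrightarrow> Measurable.pred M (\<lambda>v. takes_record \<theta> stop t (arrivals v))"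
  unfolding takes_record_def by measurable

lemma waiting_cong:
  assumes "t \<le> n" "\<And>s. s < t \<Longrightarrow> y s = y' s"
  shows "waiting stop t y = waiting stop t y'"
proof -
  have "stop s y = stop s y'" if "s < t" for s
    using that assms by (intro stop_cong) auto
  then show ?thesis by (auto simp: waiting_def)
qed

text \<open>This and the next three lemmas serve the independence premise of
  \<open>resample\<close>: what is settled before box \<open>s\<close> arrives does not react to its
  value.\<close>

lemma waiting_upd: "s < n \<Longrightarrow> t \<le> s \<Longrightarrow>
    waiting stop t (arrivals (v(\<pi> s := z))) = waiting stop t (arrivals v)"
  by (rule waiting_cong) (auto simp: order_eq_iff)

lemma runmax_upd: "s < n \<Longrightarrow> t \<le> s \<Longrightarrow>
    runmax \<theta> (arrivals (v(\<pi> s := z))) t = runmax \<theta> (arrivals v) t"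
  by (rule runmax_cong) (auto simp: order_eq_iff)

lemma stop_upd: "s < n \<Longrightarrow> t < s \<Longrightarrow>
    stop t (arrivals (v(\<pi> s := z))) = stop t (arrivals v)"
  by (rule stop_cong) (auto simp: order_eq_iff)

lemma takes_record_upd: "s < n \<Longrightarrow> t < s \<Longrightarrow>
    takes_record \<theta> stop t (arrivals (v(\<pi> s := z))) = takes_record \<theta> stop t (arrivals v)"
  using waiting_upd[of s t v z] runmax_upd[of s t v z] stop_upd[of s t v z]
  by (simp add: takes_record_def order_eq_iff)

text \<open>The probability of a weak win by accepting at time \<open>t\<close>, with the later
  boxes already integrated out; \<open>record_value_eq\<close> at \<open>m = n\<close> confirms this
  reading.\<close>

definition record_value :: "nat \<Rightarrow> real" where
  "record_value t = (\<integral>v. of_bool (takes_record \<theta> stop t (arrivals v))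
     * tail_cdf (Suc t) (v (\<pi> t)) \<partial>M)"

text \<open>The index \<open>m\<close> interpolates between the definition
  (\<open>m = Suc t\<close>) and the winning event (\<open>m = n\<close>). Resampling box
  \<open>m\<close> turns its comparison with the accepted value into the factor by which
  \<open>tail_cdf m\<close> and \<open>tail_cdf (Suc m)\<close> differ.\<close>

lemma record_value_eq:
  assumes t: "t < n" and m: "Suc t \<le> m" "m \<le> n"
  shows "(\<integral>v. of_bool (takes_record \<theta> stop t (arrivals v) \<and>
      (\<forall>r\<in>{t<..<m}. v (\<pi> r) \<le> v (\<pi> t))) * tail_cdf m (v (\<pi> t)) \<partial>M) = record_value t"
  using m
proof (induction m rule: dec_induct)
  case base
  have "{t<..<Suc t} = {}" by auto
  then show ?case by (simp add: record_value_def)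
next
  case (step m)
  then have m: "m < n" "t < m" by auto
  have i: "\<pi> m < n" using m by (simp add: order_less)
  let ?P = "\<lambda>v. takes_record \<theta> stop t (arrivals v) \<and> (\<forall>r\<in>{t<..<m}. v (\<pi> r) \<le> v (\<pi> t))"
  let ?f = "\<lambda>v z. of_bool (?P v \<and> z \<le> v (\<pi> t)) * tail_cdf (Suc m) (v (\<pi> t))"
  have [measurable]: "Measurable.pred M ?P"
    using t m by (intro pred_intros_logic pred_intros_finite pred_arrival_le measurable_takes_record) auto
  have set_eq: "{t<..<Suc m} = insert m {t<..<m}" using m by auto
  have "(\<integral>v. of_bool (takes_record \<theta> stop t (arrivals v) \<and>
      (\<forall>r\<in>{t<..<Suc m}. v (\<pi> r) \<le> v (\<pi> t))) * tail_cdf (Suc m) (v (\<pi> t)) \<partial>M)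
      = (\<integral>v. ?f v (v (\<pi> m)) \<partial>M)"
    by (intro Bochner_Integration.integral_cong) (auto simp: set_eq)
  also have "\<dots> = (\<integral>v. (\<integral>z. ?f v z \<partial>F (\<pi> m)) \<partial>M)"
  proof (rule resample(1)[OF i])
    show "(\<lambda>(v, z). ?f v z) \<in> borel_measurable (M \<Otimes>\<^sub>M borel)"
      using t by measurable
    show "?f (v(\<pi> m := z')) z = ?f v z" for v z z'
      using takes_record_upd[of m t v z'] t m by (auto simp: order_eq_iff)
  qed (auto simp: tail_cdf_nonneg tail_cdf_le_1)
  also have "\<dots> = (\<integral>v. of_bool (?P v) * tail_cdf m (v (\<pi> t)) \<partial>M)"
  proof (intro Bochner_Integration.integral_cong refl)
    fix v
    interpret B: prob_space "F (\<pi> m)" using i by (rule prob_space_box)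
    have "(\<integral>z. ?f v z \<partial>F (\<pi> m))
        = (\<integral>z. indicator {..v (\<pi> t)} z * (of_bool (?P v) * tail_cdf (Suc m) (v (\<pi> t))) \<partial>F (\<pi> m))"
      by (intro Bochner_Integration.integral_cong) (auto simp: indicator_def)
    also have "\<dots> = measure (F (\<pi> m)) {..v (\<pi> t)}
        * (of_bool (?P v) * tail_cdf (Suc m) (v (\<pi> t)))"
      by (simp add: space_box[OF i])
    finally show "(\<integral>z. ?f v z \<partial>F (\<pi> m)) = of_bool (?P v) * tail_cdf m (v (\<pi> t))"
      by (simp only: tail_cdf_rec[OF m(1)] mult_ac)
  qed
  finally show ?case using step by simp
qed

text \<open>A rule accepts for the first time at most once, so the weak wins split disjointly by
  acceptance time.\<close>

lemma prob_weak_wins: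
  "{v \<in> space M. weak_wins n \<theta> stop (arrivals v)} \<in> sets M"
  "measure M {v \<in> space M. weak_wins n \<theta> stop (arrivals v)} = (\<Sum>t<n. record_value t)"
proof -
  let ?P = "\<lambda>t v. takes_record \<theta> stop t (arrivals v) \<and> (\<forall>r\<in>{t<..<n}. v (\<pi> r) \<le> v (\<pi> t))"
  define S where "S t = {v \<in> space M. ?P t v}" for t
  have pred: "Measurable.pred M (?P t)" if "t < n" for t
    using that by (intro pred_intros_logic pred_intros_finite pred_arrival_le measurable_takes_record) auto
  then have S: "S t \<in> sets M" if "t < n" for t
    using that by (simp add: S_def pred_def)
  have eq: "{v \<in> space M. weak_wins n \<theta> stop (arrivals v)} = (\<Union>t<n. S t)"
    by (auto simp: S_def weak_wins_def)
  then show "{v \<in> space M. weak_wins n \<theta> stop (arrivals v)} \<in> sets M"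
    using S by auto
  have "takes_record \<theta> stop s y \<Longrightarrow> takes_record \<theta> stop t y \<Longrightarrow> s = t" for s t y
    by (cases s t rule: linorder_cases) (auto simp: takes_record_def waiting_def)
  then have "disjoint_family_on S {..<n}"
    by (auto simp: disjoint_family_on_def S_def)
  then have "measure M (\<Union>t<n. S t) = (\<Sum>t<n. measure M (S t))"
    using S by (intro finite_measure_finite_Union) auto
  also have "\<dots> = (\<Sum>t<n. record_value t)"
  proof (rule sum.cong)
    fix t assume "t \<in> {..<n}"
    then have t: "t < n" by simp
    have "measure M (S t) = (\<integral>v. indicator (S t) v \<partial>M)"
      using S[OF t] sets.sets_into_space by (simp add: Int_absorb2)
    also have "\<dots> = (\<integral>v. of_bool (?P t v) * tail_cdf n (v (\<pi> t)) \<partial>M)"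
      by (intro Bochner_Integration.integral_cong) (auto simp: S_def tail_cdf_n)
    also have "\<dots> = record_value t" using t by (intro record_value_eq) auto
    finally show "measure M (S t) = record_value t" .
  qed simp
  finally show "measure M {v \<in> space M. weak_wins n \<theta> stop (arrivals v)} = (\<Sum>t<n. record_value t)"
    by (simp add: eq)
qed

text \<open>The expected continuation value over the outcomes with nothing accepted so far. The
  candidate \<open>B\<close> stays a parameter, since both \<open>opt_bound\<close> and
  \<open>alg_val\<close> are inserted.\<close>

definition waiting_value :: "(nat \<Rightarrow> real \<Rightarrow> real) \<Rightarrow> nat \<Rightarrow> real" where
  "waiting_value B t = (\<integral>v. of_bool (waiting stop t (arrivals v))
     * B t (runmax \<theta> (arrivals v) t) \<partial>M)"

lemma waiting_value_0: "waiting_value B 0 = B 0 \<theta>"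
  by (simp add: waiting_value_def waiting_def prob_space)

lemma waiting_value_eq_0: "(\<And>x. B t x = 0) \<Longrightarrow> waiting_value B t = 0"
  by (simp add: waiting_value_def)

text \<open>Waiting and the record before time \<open>t\<close> depend only on earlier boxes, so box
  \<open>t\<close> can be resampled and integrated out first.\<close>

lemma integral_waiting_gain:
  fixes g :: "real \<Rightarrow> real \<Rightarrow> real"
  assumes t: "t < n"
    and g[measurable]: "(\<lambda>(x, z). g x z) \<in> borel_measurable (borel \<Otimes>\<^sub>M borel)"
    and bounds: "\<And>x z. 0 \<le> g x z" "\<And>x z. g x z \<le> 1"
  shows "integrable M (\<lambda>v. of_bool (waiting stop t (arrivals v))
      * g (runmax \<theta> (arrivals v) t) (v (\<pi> t)))"
    and "(\<integral>v. of_bool (waiting stop t (arrivals v)) * g (runmax \<theta> (arrivals v) t) (v (\<pi> t)) \<partial>M)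
      = waiting_value (\<lambda>_ x. \<integral>z. g x z \<partial>F (\<pi> t)) t"
proof -
  have i: "\<pi> t < n" using t by (rule order_less)
  let ?f = "\<lambda>v z. of_bool (waiting stop t (arrivals v)) * g (runmax \<theta> (arrivals v) t) z"
  note [measurable] = measurable_waiting[OF less_imp_le[OF t]]
    measurable_runmax[OF less_imp_le[OF t]] measurable_arrival[OF t]
  have 1: "(\<lambda>(v, z). ?f v z) \<in> borel_measurable (M \<Otimes>\<^sub>M borel)"
    by measurable
  have "(\<lambda>v. ?f v (v (\<pi> t))) \<in> borel_measurable M"
    by measurable
  then show "integrable M (\<lambda>v. ?f v (v (\<pi> t)))"
    using bounds by (intro integrable_unit) auto
  have "(\<integral>v. ?f v (v (\<pi> t)) \<partial>M) = (\<integral>v. (\<integral>z. ?f v z \<partial>F (\<pi> t)) \<partial>M)"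
  proof (rule resample(1)[OF i 1])
    show "?f (v(\<pi> t := z')) z = ?f v z" for v z z'
      using waiting_upd[of t t v z'] runmax_upd[of t t v z'] t by simp
  qed (use bounds in auto)
  then show "(\<integral>v. ?f v (v (\<pi> t)) \<partial>M) = waiting_value (\<lambda>_ x. \<integral>z. g x z \<partial>F (\<pi> t)) t"
    by (simp add: waiting_value_def)
qed

lemma integrable_waiting_value:
  fixes B :: "nat \<Rightarrow> real \<Rightarrow> real"
  assumes "t \<le> n" and [measurable]: "B t \<in> borel_measurable borel"
    and "\<And>x. 0 \<le> B t x" "\<And>x. B t x \<le> 1"
  shows "integrable M (\<lambda>v. of_bool (waiting stop t (arrivals v)) * B t (runmax \<theta> (arrivals v) t))"
proof (rule integrable_unit)
  show "(\<lambda>v. of_bool (waiting stop t (arrivals v)) * B t (runmax \<theta> (arrivals v) t))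
      \<in> borel_measurable M"
    using assms(1) by measurable
qed (use assms in auto)

text \<open>One step of dynamic programming for any rule and candidate \<open>B\<close>: stopping
  pays the tail probability at a record and 0 otherwise, going on pays \<open>B\<close> at the
  updated record.\<close>

lemma record_value_plus_waiting_value:
  fixes B :: "nat \<Rightarrow> real \<Rightarrow> real"
  assumes t: "t < n" and B: "B (Suc t) \<in> borel_measurable borel"
    "\<And>x. 0 \<le> B (Suc t) x" "\<And>x. B (Suc t) x \<le> 1"
  defines "g \<equiv> \<lambda>v. of_bool (waiting stop t (arrivals v)) *
      (if stop t (arrivals v)
       then of_bool (runmax \<theta> (arrivals v) t < v (\<pi> t)) * tail_cdf (Suc t) (v (\<pi> t))
       else B (Suc t) (max (runmax \<theta> (arrivals v) t) (v (\<pi> t))))"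
  shows "integrable M g" "record_value t + waiting_value B (Suc t) = integral\<^sup>L M g"
proof -
  let ?a = "\<lambda>v. of_bool (takes_record \<theta> stop t (arrivals v)) * tail_cdf (Suc t) (v (\<pi> t))"
  let ?b = "\<lambda>v. of_bool (waiting stop (Suc t) (arrivals v))
    * B (Suc t) (runmax \<theta> (arrivals v) (Suc t))"
  have "?a \<in> borel_measurable M" using t by measurable
  then have a: "integrable M ?a"
    by (intro integrable_unit) (auto simp: tail_cdf_nonneg tail_cdf_le_1)
  have b: "integrable M ?b"
    using t B by (intro integrable_waiting_value) auto
  have eq: "g = (\<lambda>v. ?a v + ?b v)"
    by (auto simp: g_def takes_record_def waiting_Suc)
  show "integrable M g" "record_value t + waiting_value B (Suc t) = integral\<^sup>L M g"
    unfolding eq record_value_def waiting_value_def using a b by simp_all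
qed

text \<open>A supermartingale argument: the winnings collected before time \<open>m\<close> plus the
  waiting value at \<open>m\<close> never increase with \<open>m\<close>, start at
  \<open>opt_bound 0 \<theta>\<close>, and end as the winning probability since
  \<open>opt_bound n\<close> vanishes.\<close>

lemma prob_weak_wins_le_opt_bound:
  "measure M {v \<in> space M. weak_wins n \<theta> stop (arrivals v)} \<le> opt_bound 0 \<theta>"
proof -
  have step: "record_value t + waiting_value opt_bound (Suc t) \<le> waiting_value opt_bound t"
    if t: "t < n" for t
  proof -
    note gain = integral_waiting_gain[OF t measurable_opt_gain[OF t] opt_gain_nonneg[OF t]
        opt_gain_le_1[OF t]]
    \<comment> \<open>Pointwise, accepting or passing a record pays one of the two arguments of the
      maximum in \<open>opt_gain\<close>, and accepting a non-record pays 0, which is at most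
      \<open>opt_bound\<close>.\<close>
    have "record_value t + waiting_value opt_bound (Suc t)
        \<le> (\<integral>v. of_bool (waiting stop t (arrivals v))
            * opt_gain t (runmax \<theta> (arrivals v) t) (v (\<pi> t)) \<partial>M)"
      using t by (subst record_value_plus_waiting_value(2))
        (auto intro!: integral_mono record_value_plus_waiting_value(1) gain(1)
          simp: opt_bound_nonneg opt_bound_le_1 opt_gain_nonneg[OF t],
          auto simp: opt_gain_def max_def opt_bound_nonneg)
    also have "\<dots> = waiting_value (\<lambda>_ x. \<integral>z. opt_gain t x z \<partial>F (\<pi> t)) t"
      by (rule gain(2))
    also have "\<dots> \<le> waiting_value opt_bound t"
    proof -
      interpret B: prob_space "F (\<pi> t)" using t by (intro prob_space_box order_less)
      note [measurable_cong] = sets_box[OF order_less[OF t]]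
      have "(\<lambda>x. \<integral>z. opt_gain t x z \<partial>F (\<pi> t)) \<in> borel_measurable borel"
        using t by measurable
      then show ?thesis
        unfolding waiting_value_def using t opt_bound_step[OF t]
          B.integral_unit[of "opt_gain t _", OF opt_gain_nonneg[OF t] opt_gain_le_1[OF t]]
        by (intro integral_mono mult_left_mono integrable_waiting_value)
          (auto simp: opt_bound_nonneg opt_bound_le_1)
    qed
    finally show ?thesis .
  qed
  have "(\<Sum>t<m. record_value t) + waiting_value opt_bound m \<le> opt_bound 0 \<theta>" if "m \<le> n" for m
    using that
  proof (induction m)
    case (Suc m)
    then show ?case using step[of m] by simp
  qed (simp add: waiting_value_0)
  from this[of n] show ?thesis
    by (simp add: prob_weak_wins(2) waiting_value_eq_0 opt_bound_n)
qed

text \<open>The same telescoping with equality, because the rule stops exactly in the accepting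
  branch of \<open>alg_gain\<close>.\<close>

lemma prob_weak_wins_eq_alg_val:
  assumes stop: "\<And>t y. t < n \<Longrightarrow>
    stop t y \<longleftrightarrow> runmax \<theta> y t < y t \<and> box_lambda \<le> tail_cdf (Suc t) (y t)"
  shows "measure M {v \<in> space M. weak_wins n \<theta> stop (arrivals v)} = alg_val 0 \<theta>"
proof -
  have step: "record_value t + waiting_value alg_val (Suc t) = waiting_value alg_val t"
    if t: "t < n" for t
  proof -
    have "record_value t + waiting_value alg_val (Suc t)
        = (\<integral>v. of_bool (waiting stop t (arrivals v))
            * alg_gain t (runmax \<theta> (arrivals v) t) (v (\<pi> t)) \<partial>M)"
      using t by (subst record_value_plus_waiting_value(2))
        (auto intro!: Bochner_Integration.integral_cong
          simp: alg_val_nonneg alg_val_le_1 alg_gain_def stop max_def)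
    also have "\<dots> = waiting_value (\<lambda>_ x. \<integral>z. alg_gain t x z \<partial>F (\<pi> t)) t"
      by (rule integral_waiting_gain(2)[OF t measurable_alg_gain[OF t] alg_gain_nonneg[OF t]
        alg_gain_le_1[OF t]])
    also have "\<dots> = waiting_value alg_val t"
      by (simp add: waiting_value_def alg_val_rec[OF t])
    finally show ?thesis .
  qed
  have "(\<Sum>t<m. record_value t) + waiting_value alg_val m = alg_val 0 \<theta>" if "m \<le> n" for m
    using that
  proof (induction m)
    case (Suc m)
    then show ?case using step[of m] by simp
  qed (simp add: waiting_value_0)
  from this[of n] show ?thesis
    by (simp add: prob_weak_wins(2) waiting_value_eq_0 alg_val_n)
qed

lemma measurable_wins: "{v \<in> space M. wins n \<theta> stop (arrivals v)} \<in> sets M"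
proof -
  have eq: "wins n \<theta> stop (arrivals v) \<longleftrightarrow> (\<exists>t\<in>{..<n}. takes_record \<theta> stop t (arrivals v)
      \<and> (\<forall>s\<in>{..<n} - {t}. v (\<pi> s) < v (\<pi> t)))" for v
  proof -
    have "wins n \<theta> stop y \<longleftrightarrow> (\<exists>t\<in>{..<n}. takes_record \<theta> stop t y
      \<and> (\<forall>s\<in>{..<n} - {t}. y s < y t))" for y
      unfolding wins_def takes_record_def waiting_def runmax_less_iff Bex_def
      by (intro ex_cong1) (auto dest: order.strict_trans)
    then show ?thesis .
  qed
  have "Measurable.pred M (\<lambda>v. wins n \<theta> stop (arrivals v))"
    unfolding eq
    by (intro pred_intros_finite pred_intros_logic pred_arrival_less measurable_takes_record) auto
  then show ?thesis by (simp add: pred_def)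
qed

end

section \<open>Ties and the actual algorithm\<close>

context online_boxes
begin

text \<open>Compared with \<open>alg_rule\<close>, records are strict and the tail comparison is
  weak, which matches \<open>weak_wins\<close> and \<open>alg_val\<close> at every
  threshold.\<close>

definition weak_alg_rule :: "nat \<Rightarrow> (nat \<Rightarrow> real) \<Rightarrow> bool" where
  "weak_alg_rule t y \<longleftrightarrow> runmax \<theta> y t < y t \<and> box_lambda \<le> tail_cdf (Suc t) (y t)"

lemma online_rule_weak_alg_rule: "online_rule n F \<pi> weak_alg_rule"
proof -
  have "weak_alg_rule t y = weak_alg_rule t y'" if "\<forall>s\<le>t. y s = y' s" for t y y'
    using that runmax_cong[of t y y' \<theta>] by (simp add: weak_alg_rule_def)
  moreover have "{v \<in> space M. weak_alg_rule t (arrivals v)} \<in> sets M" if "t < n" for t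
    using that measurable_runmax[OF less_imp_le[OF that]] unfolding weak_alg_rule_def by measurable
  ultimately show ?thesis unfolding online_rule_def by blast
qed

definition strict_tail_cdf :: "nat \<Rightarrow> real \<Rightarrow> real" where
  "strict_tail_cdf t x = (\<Prod>s\<in>{t..<n}. measure (F (\<pi> s)) {..<x})"

lemma measurable_strict_tail_cdf [measurable]: "strict_tail_cdf t \<in> borel_measurable borel"
proof (intro borel_measurable_mono monoI)
  fix x z :: real assume "x \<le> z"
  then have "measure (F (\<pi> s)) {..<x} \<le> measure (F (\<pi> s)) {..<z}" if "s < n" for s
    using that order_less[of s] prob_space.finite_measure[OF prob_space_box] sets_box
    by (intro finite_measure.finite_measure_mono) auto
  then show "strict_tail_cdf t x \<le> strict_tail_cdf t z"
    unfolding strict_tail_cdf_def by (auto intro!: prod_mono)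
qed

lemma measure_future_less:
  "measure (PiM {t<..<n} (\<lambda>s. F (\<pi> s)))
     {w \<in> space (PiM {t<..<n} (\<lambda>s. F (\<pi> s))). \<forall>s\<in>{t<..<n}. w s < x} = strict_tail_cdf (Suc t) x"
proof -
  \<comment> \<open>The product locale asks for a probability space at every index, so the family is
    padded by point masses from \<open>n\<close> on.\<close>
  define G where "G s = (if s < n then F (\<pi> s) else return borel 0)" for s
  have G: "prob_space (G s)" "space (G s) = UNIV" "{..<x} \<in> sets (G s)" for s
    by (auto simp: G_def prob_space_box order_less prob_space_return space_box sets_box)
  interpret finite_product_prob_space G "{t<..<n}"
    by (intro finite_product_prob_space.intro product_prob_space.intro product_sigma_finite.intro
        finite_product_sigma_finite.intro product_prob_space_axioms.intro
        finite_product_sigma_finite_axioms.intro prob_space_imp_sigma_finite G) auto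
  have PiM_eq: "PiM {t<..<n} (\<lambda>s. F (\<pi> s)) = PiM {t<..<n} G"
    by (rule PiM_cong) (auto simp: G_def)
  have "{w \<in> space (PiM {t<..<n} G). \<forall>s\<in>{t<..<n}. w s < x} = (\<Pi>\<^sub>E s\<in>{t<..<n}. {..<x})"
    by (auto simp: space_PiM G PiE_def Pi_def)
  then have "measure (PiM {t<..<n} G) {w \<in> space (PiM {t<..<n} G). \<forall>s\<in>{t<..<n}. w s < x}
      = (\<Prod>s\<in>{t<..<n}. measure (G s) {..<x})"
    by (simp add: finite_measure_PiM_emb G)
  also have "\<dots> = strict_tail_cdf (Suc t) x"
    unfolding strict_tail_cdf_def by (intro prod.cong) (auto simp: G_def)
  finally show ?thesis by (simp add: PiM_eq)
qed

lemma alg_rule_iff: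
  "alg_rule n F \<pi> \<theta> lam t y \<longleftrightarrow>
     \<theta> \<le> y t \<and> (\<forall>s\<in>{..<t}. y s \<le> y t) \<and> lam \<le> strict_tail_cdf (Suc t) (y t)"
  by (auto simp: alg_rule_def measure_future_less)

lemma online_rule_alg_rule: "online_rule n F \<pi> (alg_rule n F \<pi> \<theta> lam)"
proof -
  have "Measurable.pred M (\<lambda>v. alg_rule n F \<pi> \<theta> lam t (arrivals v))" if "t < n" for t
  proof -
    have "Measurable.pred M (\<lambda>v. \<forall>s\<in>{..<t}. v (\<pi> s) \<le> v (\<pi> t))"
      using that by (intro pred_intros_finite pred_arrival_le) auto
    then show ?thesis using that unfolding alg_rule_iff by measurable
  qed
  then show ?thesis by (auto simp: online_rule_def alg_rule_iff pred_def)
qed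

text \<open>Resampling box \<open>j\<close> shows that the expected mass of \<open>F j\<close> at
  \<open>v i\<close> is the probability of a tie between the two boxes, which is 0; a nonnegative
  function with integral 0 vanishes almost everywhere.\<close>

lemma AE_no_atom:
  assumes inj: "AE v in M. inj_on v {..<n}" and ij: "i < n" "j < n" "i \<noteq> j"
  shows "AE v in M. measure (F j) {v i} = 0"
proof -
  let ?f = "\<lambda>v z. of_bool (z = v i) :: real"
  interpret B: prob_space "F j" using ij by (simp add: prob_space_box)
  note [measurable] = measurable_box[OF ij(1)]
  have f: "(\<lambda>(v, z). ?f v z) \<in> borel_measurable (M \<Otimes>\<^sub>M borel)" by measurable
  have eq: "(\<integral>z. ?f v z \<partial>F j) = measure (F j) {v i}" for v
  proof -
    have "(\<integral>z. ?f v z \<partial>F j) = (\<integral>z. indicator {v i} z \<partial>F j)"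
      by (intro Bochner_Integration.integral_cong) (auto simp: indicator_def)
    then show ?thesis using ij by (simp add: space_box)
  qed
  note res = resample[OF ij(2) f, unfolded eq]
  have "(\<integral>v. ?f v (v j) \<partial>M) = 0"
  proof (rule integral_eq_zero_AE)
    show "AE v in M. ?f v (v j) = 0"
      using inj by eventually_elim (use ij in \<open>auto simp: inj_on_def\<close>)
  qed
  then have "(\<integral>v. measure (F j) {v i} \<partial>M) = 0"
    using res(1) ij by simp
  moreover have "integrable M (\<lambda>v. measure (F j) {v i})"
    using res(2) ij by (intro integrable_unit) (auto simp: measure_box_le_1)
  ultimately show ?thesis by (simp add: integral_nonneg_eq_0_iff_AE)
qed

text \<open>Without ties, strict and weak comparisons between realized values agree. The acceptance
  tests also involve the distributions of future boxes, and these agree because realized values are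
  almost surely not atoms of other boxes.\<close>

lemma AE_alg_rule_wins_iff:
  assumes "AE v in M. \<theta> \<notin> v ` {..<n} \<and> inj_on v {..<n}"
  shows "AE v in M. wins n \<theta> (alg_rule n F \<pi> \<theta> box_lambda) (arrivals v)
    \<longleftrightarrow> weak_wins n \<theta> weak_alg_rule (arrivals v)"
proof -
  have inj: "AE v in M. inj_on v {..<n}" using assms by eventually_elim auto
  have "AE v in M. \<forall>i\<in>{..<n}. \<forall>j\<in>{..<n} - {i}. measure (F j) {v i} = 0"
    by (intro AE_finite_allI) (auto intro: AE_no_atom[OF inj])
  with assms show ?thesis
  proof eventually_elim
    case (elim v)
    let ?y = "arrivals v"
    have ne: "?y s \<noteq> ?y t" if "s < n" "t < n" "s \<noteq> t" for s t
      using that elim(1) order_less[of s] order_less[of t] order_eq_iff[of s t]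
      by (auto simp: inj_on_def)
    have ne\<theta>: "\<theta> \<noteq> ?y t" if "t < n" for t
      using that elim(1) order_less[of t] by auto
    have tail: "strict_tail_cdf (Suc t) (?y t) = tail_cdf (Suc t) (?y t)" if t: "t < n" for t
      unfolding strict_tail_cdf_def tail_cdf_def
    proof (rule prod.cong)
      fix s assume "s \<in> {Suc t..<n}"
      then have s: "s < n" "s \<noteq> t" by auto
      then have i: "\<pi> s < n" "\<pi> s \<noteq> \<pi> t" using order_eq_iff t by (auto simp: order_less)
      interpret B: prob_space "F (\<pi> s)" using i by (simp add: prob_space_box)
      have "{..?y t} = {..<?y t} \<union> {?y t}" by auto
      then have "measure (F (\<pi> s)) {..?y t}
          = measure (F (\<pi> s)) {..<?y t} + measure (F (\<pi> s)) {?y t}"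
        using i by (simp only:) (rule B.finite_measure_Union, auto simp: sets_box)
      moreover have "measure (F (\<pi> s)) {?y t} = 0"
        using elim(2) i order_less[OF t] by auto
      ultimately show "measure (F (\<pi> s)) {..<?y t} = measure (F (\<pi> s)) {..?y t}" by simp
    qed simp
    have "alg_rule n F \<pi> \<theta> box_lambda t ?y = weak_alg_rule t ?y" if t: "t < n" for t
    proof -
      have "\<theta> \<le> ?y t \<longleftrightarrow> \<theta> < ?y t" using ne\<theta>[OF t] by auto
      moreover have "?y s \<le> ?y t \<longleftrightarrow> ?y s < ?y t" if "s < t" for s
        using ne[of s t] that t by auto
      ultimately show ?thesis
        by (auto simp: alg_rule_iff weak_alg_rule_def runmax_less_iff tail[OF t])
    qed
    then have "wins n \<theta> (alg_rule n F \<pi> \<theta> box_lambda) ?y = wins n \<theta> weak_alg_rule ?y"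
      unfolding wins_def by (intro ex_cong1 conj_cong refl) auto
    also have "\<dots> = weak_wins n \<theta> weak_alg_rule ?y"
    proof
      assume "weak_wins n \<theta> weak_alg_rule ?y"
      then obtain t where t: "t < n" "takes_record \<theta> weak_alg_rule t ?y"
        and later: "\<forall>r\<in>{t<..<n}. ?y r \<le> ?y t"
        by (auto simp: weak_wins_def)
      have "?y s < ?y t" if "s < n" "s \<noteq> t" for s
      proof (cases "s < t")
        case True
        then show ?thesis using t(2) by (simp add: takes_record_def runmax_less_iff)
      next
        case False
        then have "?y s \<le> ?y t" using that later by auto
        then show ?thesis using ne[of s t] that t(1) by simp
      qed
      then show "wins n \<theta> weak_alg_rule ?y"
        using t unfolding wins_def takes_record_def waiting_def runmax_less_iff by blast
    qed (rule wins_imp_weak_wins)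
    finally show ?case .
  qed
qed

text \<open>The original rule is interpreted only for measurability of its winning event; the value
  comes from the weak rule.\<close>

lemma win_prob_alg_rule:
  assumes "AE v in M. \<theta> \<notin> v ` {..<n} \<and> inj_on v {..<n}"
  shows "win_prob n F \<pi> \<theta> (alg_rule n F \<pi> \<theta> box_lambda) = alg_val 0 \<theta>"
proof -
  interpret A: online_strategy n F \<theta> \<pi> "alg_rule n F \<pi> \<theta> box_lambda"
    by unfold_locales (rule online_rule_alg_rule)
  interpret W: online_strategy n F \<theta> \<pi> weak_alg_rule
    by unfold_locales (rule online_rule_weak_alg_rule)
  have "win_prob n F \<pi> \<theta> (alg_rule n F \<pi> \<theta> box_lambda)
      = measure M {v \<in> space M. weak_wins n \<theta> weak_alg_rule (arrivals v)}"
    unfolding win_prob_def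
  proof (rule measure_eq_AE[OF _ A.measurable_wins W.prob_weak_wins(1)])
    show "AE v in M. v \<in> {v \<in> space M. wins n \<theta> (alg_rule n F \<pi> \<theta> box_lambda) (arrivals v)}
        \<longleftrightarrow> v \<in> {v \<in> space M. weak_wins n \<theta> weak_alg_rule (arrivals v)}"
      using AE_alg_rule_wins_iff[OF assms] by eventually_elim simp
  qed
  also have "\<dots> = alg_val 0 \<theta>"
    by (rule W.prob_weak_wins_eq_alg_val) (simp add: weak_alg_rule_def)
  finally show ?thesis .
qed

lemma OPT_le_opt_bound: "OPT n F \<pi> \<theta> \<le> opt_bound 0 \<theta>"
  unfolding OPT_def
proof (rule cSup_least)
  \<comment> \<open>Bounding a real supremum requires a nonempty set, so some online rule has to be
    exhibited.\<close>
  show "win_prob n F \<pi> \<theta> ` {stop. online_rule n F \<pi> stop} \<noteq> {}"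
    using online_rule_weak_alg_rule by blast
  fix p assume "p \<in> win_prob n F \<pi> \<theta> ` {stop. online_rule n F \<pi> stop}"
  then obtain stop where stop: "online_rule n F \<pi> stop" and p: "p = win_prob n F \<pi> \<theta> stop"
    by auto
  interpret S: online_strategy n F \<theta> \<pi> stop
    by unfold_locales (rule stop)
  have "p \<le> measure M {v \<in> space M. weak_wins n \<theta> stop (arrivals v)}"
    unfolding p win_prob_def
    by (intro finite_measure_mono S.prob_weak_wins(1)) (auto intro: wins_imp_weak_wins)
  also have "\<dots> \<le> opt_bound 0 \<theta>" by (rule S.prob_weak_wins_le_opt_bound)
  finally show "p \<le> opt_bound 0 \<theta>" .
qed

end

theorem theorem4p1:
  fixes n :: nat and F :: "nat \<Rightarrow> real measure" and \<theta> :: real and \<pi> :: "nat \<Rightarrow> nat"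
  assumes "\<forall>i<n. prob_space (F i)"
    and "\<forall>i<n. sets (F i) = sets borel"
    and "\<theta> \<ge> 0"
    and "AE v in box_space n F. \<theta> \<notin> v ` {..<n} \<and> inj_on v {..<n}"
    and "bij_betw \<pi> {..<n} {..<n}"
  shows "win_prob n F \<pi> \<theta> (alg_rule n F \<pi> \<theta> box_lambda) \<ge> ln (1 / box_lambda) * OPT n F \<pi> \<theta>"
proof -
  interpret online_boxes n F \<theta> \<pi>
    by (rule online_boxes.intro) (simp_all add: assms(1,2,5))
  have "ln (1 / box_lambda) * OPT n F \<pi> \<theta> \<le> ln (1 / box_lambda) * opt_bound 0 \<theta>"
    by (rule mult_left_mono[OF OPT_le_opt_bound less_imp_le[OF ln_inverse_box_lambda_pos]])
  also have "\<dots> \<le> alg_val 0 \<theta>"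
    by (rule opt_bound_le_alg_val)
  also have "\<dots> = win_prob n F \<pi> \<theta> (alg_rule n F \<pi> \<theta> box_lambda)"
    by (rule win_prob_alg_rule[OF assms(4), symmetric])
  finally show ?thesis .
qed

end
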